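(* Let $f=\sum_{i=1}^m c_i\mathbf{x}^{\boldsymbol{\alpha}_i}-d_0\mathbf{x}^{\boldsymbol{\beta}}\in\mathbb{R}[x_1,\ldots,x_n]$ with $\boldsymbol{\alpha}_i\in(2\mathbb{N})^n$ and $c_i>0$ for $i=1,\ldots,m$, $\boldsymbol{\beta}\in\mathbb{N}^n$, $d_0\in\mathbb{R}$. Then $f\in\mathrm{PSD}$ if and only if $f\in\mathrm{SONC}$.
   Context: Here $\mathbb{N}$ contains $0$, and $\mathbf{x}^{\boldsymbol{\alpha}}=x_1^{\alpha_1}\cdots x_n^{\alpha_n}$. $\mathrm{PSD}$ is the set of polynomials in $\mathbb{R}[x_1,\ldots,x_n]$ that are nonnegative on all of $\mathbb{R}^n$. A trellis is a finite set $\mathscr{A}\subseteq(2\mathbb{N})^n$ comprising the vertices of a simplex (of any dimension, i.e. $\mathscr{A}$ is affinely independent). A circuit polynomial is a polynomial of the form $\sum_{\boldsymbol{\alpha}\in\mathscr{A}}c_{\boldsymbol{\alpha}}\mathbf{x}^{\boldsymbol{\alpha}}-d\mathbf{x}^{\boldsymbol{\beta}}$ where $\mathscr{A}$ is a trellis, $c_{\boldsymbol{\alpha}}>0$ for all $\boldsymbol{\alpha}\in\mathscr{A}$, $d\in\mathbb{R}$, and $\boldsymbol{\beta}\in\mathbb{N}^n$ lies in the relative interior of the convex hull of $\mathscr{A}$. A nonnegative circuit polynomial is a circuit polynomial that is nonnegative on $\mathbb{R}^n$; by convention a monomial square $c\mathbf{x}^{\boldsymbol{\alpha}}$ with $c>0$,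 $\boldsymbol{\alpha}\in(2\mathbb{N})^n$ is also regarded as a nonnegative circuit polynomial. $\mathrm{SONC}$ is the convex cone of all (finite, possibly empty) sums of nonnegative circuit polynomials in $\mathbb{R}[x_1,\ldots,x_n]$. *)

theory Defs
  imports "HOL-Analysis.Analysis" "HOL-Library.Poly_Mapping"
begin

text \<open>
  The ring of real polynomials in variables indexed by \<open>'n\<close> is the monoid algebra of
  the additive monoid \<open>nat ^ 'n\<close> of exponent vectors: a polynomial is its finitely supported
  coefficient function, with the convolution product of \<^theory>\<open>HOL-Library.Poly_Mapping\<close>.
\<close>

type_synonym 'n polynomial = "(nat ^ 'n) \<Rightarrow>\<^sub>0 real"

abbreviation monomial :: "real \<Rightarrow> nat ^ 'n \<Rightarrow> 'n polynomial" where
  "monomial c \<alpha> \<equiv> Poly_Mapping.single \<alpha> c"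

definition eval_polynomial :: "'n::finite polynomial \<Rightarrow> real ^ 'n \<Rightarrow> real" where
  "eval_polynomial f x =
     (\<Sum>\<alpha>\<in>Poly_Mapping.keys f. Poly_Mapping.lookup f \<alpha> * (\<Prod>i\<in>UNIV. x $ i ^ (\<alpha> $ i)))"

definition PSD :: "'n::finite polynomial set" where
  "PSD = {f. \<forall>x. eval_polynomial f x \<ge> 0}"

definition even_vec :: "nat ^ 'n \<Rightarrow> bool" where
  "even_vec \<alpha> \<longleftrightarrow> (\<forall>i. even (\<alpha> $ i))"

definition real_vec :: "nat ^ 'n \<Rightarrow> real ^ 'n" where
  "real_vec \<alpha> = (\<chi> i. real (\<alpha> $ i))"

definition trellis :: "(nat ^ 'n::finite) set \<Rightarrow> bool" where
  "trellis A \<longleftrightarrow> finite A \<and> (\<forall>\<alpha>\<in>A. even_vec \<alpha>) \<and> \<not> affine_dependent (real_vec ` A)"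

text \<open>
  The empty trellis gives no circuit polynomial, since the relative interior of its convex hull is
  empty. For a singleton trellis the relative interior is the point itself, so then \<open>\<beta>\<close> is its vertex.
\<close>

definition circuit_polynomial :: "'n::finite polynomial \<Rightarrow> bool" where
  "circuit_polynomial f \<longleftrightarrow>
     (\<exists>A c d \<beta>. trellis A \<and> (\<forall>\<alpha>\<in>A. c \<alpha> > 0) \<and>
        real_vec \<beta> \<in> rel_interior (convex hull (real_vec ` A)) \<and>
        f = (\<Sum>\<alpha>\<in>A. monomial (c \<alpha>) \<alpha>) - monomial d \<beta>)"

definition monomial_square :: "'n::finite polynomial \<Rightarrow> bool" where
  "monomial_square f \<longleftrightarrow> (\<exists>c \<alpha>. c > 0 \<and> even_vec \<alpha> \<and> f = monomial c \<alpha>)"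

definition nonneg_circuit_polynomial :: "'n::finite polynomial \<Rightarrow> bool" where
  "nonneg_circuit_polynomial f \<longleftrightarrow> (circuit_polynomial f \<and> f \<in> PSD) \<or> monomial_square f"

definition SONC :: "'n::finite polynomial set" where
  "SONC = {sum_list fs | fs. \<forall>f\<in>set fs. nonneg_circuit_polynomial f}"

end

theory Submission
  imports Defs
begin

text \<open>
  Sums of nonnegative polynomials are nonnegative, so only the decomposition of a nonnegative
  \<open>f = (\<Sum>\<alpha>\<in>A. c \<alpha> x\<^sup>\<alpha>) - d x\<^sup>\<beta>\<close> needs an argument.  If \<open>- d x\<^sup>\<beta>\<close> is itself zero or a monomial
  square, \<open>f\<close> is a sum of monomial squares.  Otherwise the substitution \<open>x = \<plusminus> exp y\<close>, with signs
  that make the last term negative, turns nonnegativity of \<open>f\<close> into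
  \<open>F y = (\<Sum>\<alpha>\<in>A. c \<alpha> exp ((\<alpha> - \<beta>) \<bullet> y)) \<ge> \<bar>d\<bar>\<close> for all \<open>y\<close>
  (\<open>exp_inequality_if_PSD\<close>), and \<open>PSD_if_exp_inequality\<close> leads back.

  The infimum of \<open>F\<close> need not be attained, but it is when \<open>A\<close> is replaced by a minimal subset
  \<open>B\<close> for which the lower bound \<open>\<bar>d\<bar>\<close> persists
  (\<open>exp_sum_bounded_below_critical_subsum\<close>); the terms outside \<open>B\<close> are monomial squares.
  At a minimizer \<open>y\<close> the gradient vanishes.  So the positive weights
  \<open>w \<alpha> = c \<alpha> exp ((\<alpha> - \<beta>) \<bullet> y)\<close> are balanced around \<open>\<beta>\<close>, that is,
  \<open>(\<Sum>\<alpha>\<in>B. w \<alpha> (\<alpha> - \<beta>)) = 0\<close>, and their total is \<open>F y \<ge> \<bar>d\<bar>\<close>.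

  A Caratheodory argument (\<open>convex_hull_minimal_simplex\<close>) splits balanced weights into balanced
  weights supported on simplices with \<open>\<beta>\<close> in the relative interior.  Multiplied by
  \<open>exp (- (\<alpha> - \<beta>) \<bullet> y)\<close>, each part gives the coefficients of one circuit polynomial; the
  coefficient \<open>d\<close> is shared out in proportion to the total weights.  Each of these
  circuit polynomials is nonnegative by the weighted inequality of arithmetic and geometric means
  (\<open>balanced_PSD\<close>).
\<close>

section \<open>Evaluation of polynomials\<close>

abbreviation vec_power :: "real ^ 'n::finite \<Rightarrow> nat ^ 'n \<Rightarrow> real" where
  "vec_power x \<alpha> \<equiv> (\<Prod>i\<in>UNIV. x $ i ^ (\<alpha> $ i))"

lemma eval_polynomial_superset:
  assumes "finite K" "Poly_Mapping.keys f \<subseteq> K"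
  shows "eval_polynomial f x = (\<Sum>\<alpha>\<in>K. Poly_Mapping.lookup f \<alpha> * vec_power x \<alpha>)"
  unfolding eval_polynomial_def
  by (rule sum.mono_neutral_left) (use assms in \<open>auto simp: in_keys_iff\<close>)

lemma eval_polynomial_zero [simp]: "eval_polynomial 0 x = 0"
  by (simp add: eval_polynomial_def)

lemma eval_polynomial_monomial [simp]: "eval_polynomial (monomial c \<alpha>) x = c * vec_power x \<alpha>"
  by (subst eval_polynomial_superset[of "{\<alpha>}"]) auto

lemma eval_polynomial_add [simp]:
  "eval_polynomial (f + g) x = eval_polynomial f x + eval_polynomial g x"
proof -
  let ?K = "Poly_Mapping.keys f \<union> Poly_Mapping.keys g"
  have "eval_polynomial h x = (\<Sum>\<alpha>\<in>?K. Poly_Mapping.lookup h \<alpha> * vec_power x \<alpha>)"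
    if "h \<in> {f, g, f + g}" for h
    using that Poly_Mapping.keys_add[of f g] by (intro eval_polynomial_superset) auto
  then show ?thesis
    by (simp add: lookup_add distrib_right sum.distrib)
qed

lemma eval_polynomial_diff [simp]:
  "eval_polynomial (f - g) x = eval_polynomial f x - eval_polynomial g x"
  using eval_polynomial_add[of "f - g" g x] by simp

lemma eval_polynomial_sum [simp]:
  "eval_polynomial (\<Sum>i\<in>I. f i) x = (\<Sum>i\<in>I. eval_polynomial (f i) x)"
  by (induction I rule: infinite_finite_induct) auto

lemma vec_power_exp: "vec_power (\<chi> i. exp (y $ i)) \<alpha> = exp (real_vec \<alpha> \<bullet> y)"
  by (simp add: inner_vec_def real_vec_def exp_sum exp_of_nat_mult)

lemma vec_power_mult: "vec_power (\<chi> i. x $ i * z $ i) \<alpha> = vec_power x \<alpha> * vec_power z \<alpha>"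
  by (simp add: power_mult_distrib prod.distrib)

lemma vec_power_abs: "vec_power (\<chi> i. \<bar>x $ i\<bar>) \<alpha> = \<bar>vec_power x \<alpha>\<bar>"
  by (simp add: abs_prod power_abs)

lemma vec_power_even_nonneg: "even_vec \<alpha> \<Longrightarrow> vec_power x \<alpha> \<ge> 0"
  by (auto simp: even_vec_def intro!: prod_nonneg zero_le_even_power)

text \<open>Both sides depend continuously on the point, so strict positivity of the coordinates may be
  relaxed; the even exponents then allow passing from \<open>\<bar>x\<bar>\<close> to \<open>x\<close>.\<close>
lemma PSD_if_exp_inequality:
  assumes even: "\<And>\<alpha>. \<alpha> \<in> A \<Longrightarrow> even_vec \<alpha>"
    and ineq: "\<And>y. (\<Sum>\<alpha>\<in>A. c \<alpha> * exp (real_vec \<alpha> \<bullet> y)) \<ge> D * exp (real_vec \<beta> \<bullet> y)"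
    and "\<bar>d\<bar> \<le> D"
  shows "(\<Sum>\<alpha>\<in>A. monomial (c \<alpha>) \<alpha>) - monomial d \<beta> \<in> PSD"
proof -
  have "(\<Sum>\<alpha>\<in>A. c \<alpha> * vec_power x \<alpha>) - d * vec_power x \<beta> \<ge> 0" for x :: "real ^ 'a"
  proof -
    let ?z = "\<lambda>e::real. \<chi> i. \<bar>x $ i\<bar> + e"
    have pos: "(\<Sum>\<alpha>\<in>A. c \<alpha> * vec_power (?z e) \<alpha>) - D * vec_power (?z e) \<beta> \<ge> 0" if "e > 0" for e
    proof -
      have "?z e = (\<chi> i. exp ((\<chi> j. ln (\<bar>x $ j\<bar> + e)) $ i))"
        using that by (simp add: vec_eq_iff add_nonneg_pos)
      then show ?thesis
        using ineq[of "\<chi> j. ln (\<bar>x $ j\<bar> + e)"] by (simp only: vec_power_exp)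
    qed
    have "((\<lambda>e. (\<Sum>\<alpha>\<in>A. c \<alpha> * vec_power (?z e) \<alpha>) - D * vec_power (?z e) \<beta>) \<longlongrightarrow>
        (\<Sum>\<alpha>\<in>A. c \<alpha> * vec_power (?z 0) \<alpha>) - D * vec_power (?z 0) \<beta>) (at_right 0)"
      by (simp only: vec_lambda_beta) (intro tendsto_intros)
    then have "(\<Sum>\<alpha>\<in>A. c \<alpha> * vec_power (?z 0) \<alpha>) - D * vec_power (?z 0) \<beta> \<ge> 0"
      by (rule tendsto_lowerbound)
        (use pos in \<open>auto simp: eventually_at_right_less intro!: eventually_at_rightI[of 0 1]\<close>)
    then have "(\<Sum>\<alpha>\<in>A. c \<alpha> * \<bar>vec_power x \<alpha>\<bar>) \<ge> D * \<bar>vec_power x \<beta>\<bar>"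
      by (simp add: vec_power_abs[symmetric])
    moreover have "(\<Sum>\<alpha>\<in>A. c \<alpha> * \<bar>vec_power x \<alpha>\<bar>) = (\<Sum>\<alpha>\<in>A. c \<alpha> * vec_power x \<alpha>)"
      using even by (intro sum.cong refl) (metis abs_of_nonneg vec_power_even_nonneg)
    moreover have "d * vec_power x \<beta> \<le> D * \<bar>vec_power x \<beta>\<bar>"
    proof -
      have "d * vec_power x \<beta> \<le> \<bar>d\<bar> * \<bar>vec_power x \<beta>\<bar>"
        using abs_ge_self[of "d * vec_power x \<beta>"] by (simp only: abs_mult)
      also have "\<dots> \<le> D * \<bar>vec_power x \<beta>\<bar>"
        using assms(3) by (intro mult_right_mono) auto
      finally show ?thesis .
    qed
    ultimately show ?thesis by linarith
  qed
  then show ?thesis by (simp add: PSD_def)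
qed

text \<open>If \<open>d\<close> is negative, then \<open>\<beta>\<close> has an odd coordinate, and negating that coordinate of the point
  turns \<open>d\<close> into \<open>\<bar>d\<bar>\<close> while it fixes the even monomials.\<close>
lemma exp_inequality_if_PSD:
  assumes even: "\<And>\<alpha>. \<alpha> \<in> A \<Longrightarrow> even_vec \<alpha>"
    and psd: "(\<Sum>\<alpha>\<in>A. monomial (c \<alpha>) \<alpha>) - monomial d \<beta> \<in> PSD"
    and sgn: "d < 0 \<Longrightarrow> \<not> even_vec \<beta>"
  shows "(\<Sum>\<alpha>\<in>A. c \<alpha> * exp (real_vec \<alpha> \<bullet> y)) \<ge> \<bar>d\<bar> * exp (real_vec \<beta> \<bullet> y)"
proof -
  obtain s :: "real ^ 'a" where s1: "\<And>\<alpha>. even_vec \<alpha> \<Longrightarrow> vec_power s \<alpha> = 1"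
    and s2: "d * vec_power s \<beta> = \<bar>d\<bar>"
  proof (cases "d < 0")
    case True
    then obtain j where j: "odd (\<beta> $ j)" using sgn by (auto simp: even_vec_def)
    let ?s = "(\<chi> i. if i = j then -1 else 1) :: real ^ 'a"
    have *: "vec_power ?s \<alpha> = (-1) ^ (\<alpha> $ j)" for \<alpha>
    proof -
      have "vec_power ?s \<alpha> = (\<Prod>i\<in>UNIV. if i = j then (-1) ^ (\<alpha> $ j) else 1)"
        by (rule prod.cong) auto
      then show ?thesis by simp
    qed
    show ?thesis
      by (rule that[of ?s]; subst *) (use True j in \<open>auto simp: even_vec_def\<close>)
  next
    case False
    then show ?thesis by (intro that[of "\<chi> i. 1"]) auto
  qed
  let ?x = "\<chi> i. s $ i * (\<chi> i. exp (y $ i)) $ i"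
  have "eval_polynomial ((\<Sum>\<alpha>\<in>A. monomial (c \<alpha>) \<alpha>) - monomial d \<beta>) ?x \<ge> 0"
    using psd by (simp only: PSD_def mem_Collect_eq)
  then have "(\<Sum>\<alpha>\<in>A. c \<alpha> * vec_power ?x \<alpha>) \<ge> d * vec_power ?x \<beta>"
    by (simp del: vec_lambda_beta)
  moreover have "(\<Sum>\<alpha>\<in>A. c \<alpha> * vec_power ?x \<alpha>) = (\<Sum>\<alpha>\<in>A. c \<alpha> * exp (real_vec \<alpha> \<bullet> y))"
    by (intro sum.cong refl, subst vec_power_mult, subst vec_power_exp) (simp add: even s1)
  moreover have "d * vec_power ?x \<beta> = \<bar>d\<bar> * exp (real_vec \<beta> \<bullet> y)"
    by (subst vec_power_mult, subst vec_power_exp, subst s2[symmetric]) simp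
  ultimately show ?thesis by simp
qed

section \<open>The cone of sums of nonnegative circuit polynomials\<close>

lemma zero_in_SONC: "0 \<in> SONC"
  unfolding SONC_def by (auto intro!: exI[of _ "[]"])

lemma nonneg_circuit_in_SONC: "nonneg_circuit_polynomial f \<Longrightarrow> f \<in> SONC"
  unfolding SONC_def by (auto intro!: exI[of _ "[f]"])

lemma SONC_add: assumes "f \<in> SONC" "g \<in> SONC" shows "f + g \<in> SONC"
proof -
  obtain fs gs where "f = sum_list fs" "g = sum_list gs"
    "\<forall>h\<in>set fs. nonneg_circuit_polynomial h" "\<forall>h\<in>set gs. nonneg_circuit_polynomial h"
    using assms unfolding SONC_def by auto
  then show ?thesis unfolding SONC_def by (auto intro!: exI[of _ "fs @ gs"])
qed

lemma sum_in_SONC: "(\<And>i. i \<in> I \<Longrightarrow> f i \<in> SONC) \<Longrightarrow> (\<Sum>i\<in>I. f i) \<in> SONC"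
  by (induction I rule: infinite_finite_induct) (auto simp: zero_in_SONC SONC_add)

lemma even_monomial_in_SONC:
  assumes "c \<ge> 0" "even_vec \<alpha>" shows "monomial c \<alpha> \<in> SONC"
proof (cases "c = 0")
  case False
  then have "monomial_square (monomial c \<alpha>)"
    using assms unfolding monomial_square_def by (intro exI[of _ c] exI[of _ \<alpha>]) auto
  then show ?thesis by (simp add: nonneg_circuit_in_SONC nonneg_circuit_polynomial_def)
qed (simp add: zero_in_SONC)

lemma SONC_subset_PSD: "SONC \<subseteq> PSD"
proof
  fix f :: "'a polynomial" assume "f \<in> SONC"
  then obtain fs where "f = sum_list fs" "\<forall>g\<in>set fs. nonneg_circuit_polynomial g"
    unfolding SONC_def by auto
  moreover have "g \<in> PSD" if "nonneg_circuit_polynomial g" for g :: "'a polynomial"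
    using that
    by (auto simp: nonneg_circuit_polynomial_def monomial_square_def PSD_def
        intro!: mult_nonneg_nonneg vec_power_even_nonneg)
  ultimately have "\<forall>g\<in>set fs. g \<in> PSD" "f = sum_list fs" by auto
  then show "f \<in> PSD" by (induction fs arbitrary: f) (auto simp: PSD_def)
qed

section \<open>Critical points of exponential sums\<close>

text \<open>On the span of the exponents the sum grows at least linearly, because a direction along which
  no exponent increases is orthogonal to all of them.  So the minimum over the span exists, and the
  gradient, which lies in the span, vanishes there.\<close>
lemma exp_sum_has_critical_point:
  fixes v :: "'i \<Rightarrow> 'a::euclidean_space"
  assumes fin: "finite A" and c: "\<And>i. i \<in> A \<Longrightarrow> c i > 0"
    and dir: "\<And>u. (\<And>i. i \<in> A \<Longrightarrow> v i \<bullet> u \<le> 0) \<Longrightarrow> (\<And>i. i \<in> A \<Longrightarrow> v i \<bullet> u = 0)"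
  obtains y where "(\<Sum>i\<in>A. (c i * exp (v i \<bullet> y)) *\<^sub>R v i) = 0"
proof -
  define F where "F y = (\<Sum>i\<in>A. c i * exp (v i \<bullet> y))" for y
  define g where "g y = (\<Sum>i\<in>A. c i * max 0 (v i \<bullet> y))" for y
  let ?S = "span (v ` A)"
  have g_pos: "g u > 0" if "u \<in> ?S" "u \<noteq> 0" for u
  proof (rule ccontr)
    have nn: "c i * max 0 (v i \<bullet> u) \<ge> 0" if "i \<in> A" for i
      using c[OF that] by simp
    assume "\<not> g u > 0"
    moreover have "g u \<ge> 0" unfolding g_def by (rule sum_nonneg[OF nn])
    ultimately have "g u = 0" by simp
    then have "\<forall>i\<in>A. c i * max 0 (v i \<bullet> u) = 0"
      unfolding g_def by (subst (asm) sum_nonneg_eq_0_iff[OF fin nn])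
    then have "\<forall>i\<in>A. v i \<bullet> u \<le> 0" using c by (fastforce simp: max_def split: if_splits)
    then have "\<forall>i\<in>A. v i \<bullet> u = 0" using dir by blast
    then have "\<And>x. x \<in> v ` A \<Longrightarrow> orthogonal u x"
      by (auto simp: orthogonal_def inner_commute[of u])
    then have "orthogonal u u" using that(1) by (rule orthogonal_to_span[rotated])
    then show False using that(2) by (simp add: orthogonal_self)
  qed
  obtain \<delta> where \<delta>: "\<delta> > 0" "\<And>u. u \<in> ?S \<Longrightarrow> norm u = 1 \<Longrightarrow> \<delta> \<le> g u"
  proof (cases "?S \<inter> sphere 0 1 = {}")
    case True
    then show ?thesis by (intro that[of 1]) auto
  next
    case False
    have "compact (?S \<inter> sphere 0 1)" by (simp add: closed_Int_compact)
    moreover have "continuous_on (?S \<inter> sphere 0 1) g"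
      unfolding g_def by (intro continuous_intros)
    ultimately obtain u0 where "u0 \<in> ?S \<inter> sphere 0 1" "\<And>u. u \<in> ?S \<inter> sphere 0 1 \<Longrightarrow> g u0 \<le> g u"
      using continuous_attains_inf[OF _ False] by metis
    then show ?thesis by (intro that[of "g u0"] g_pos) auto
  qed
  have growth: "F y \<ge> \<delta> * norm y" if "y \<in> ?S" for y
  proof (cases "y = 0")
    case False
    have "\<delta> \<le> g ((1 / norm y) *\<^sub>R y)"
      using that False by (intro \<delta>) (auto intro: span_scale)
    also have "\<dots> = (1 / norm y) * g y"
      using False unfolding g_def sum_distrib_left
      by (intro sum.cong) (auto simp: max_def field_simps zero_le_divide_iff)
    finally have "\<delta> * norm y \<le> g y" using False by (simp add: field_simps)
    also have "g y \<le> F y"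
    proof -
      have "max 0 t \<le> exp t" for t :: real
        using exp_ge_add_one_self[of t] exp_gt_zero[of t] by linarith
      then show ?thesis
        unfolding g_def F_def using c by (intro sum_mono mult_left_mono) (auto simp: less_imp_le)
    qed
    finally show ?thesis .
  qed (use c in \<open>auto simp: F_def less_imp_le intro!: sum_nonneg\<close>)
  define R where "R = F 0 / \<delta>"
  have F0: "F 0 \<ge> 0" using growth[of 0] by (simp add: span_0)
  have R: "R \<ge> 0" using F0 \<delta> by (simp add: R_def)
  have "compact (?S \<inter> cball 0 R)" by (simp add: closed_Int_compact)
  moreover have "0 \<in> ?S \<inter> cball 0 R" using R by (simp add: span_0)
  moreover have "continuous_on (?S \<inter> cball 0 R) F"
    unfolding F_def by (intro continuous_intros)
  ultimately obtain y where y: "y \<in> ?S \<inter> cball 0 R" "\<And>z. z \<in> ?S \<inter> cball 0 R \<Longrightarrow> F y \<le> F z"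
    using continuous_attains_inf[of "?S \<inter> cball 0 R" F] by blast
  have min: "F y \<le> F z" if "z \<in> ?S" for z
  proof (cases "norm z \<le> R")
    case False
    have "F y \<le> F 0" using y R by (auto simp: span_0)
    also have "F 0 = \<delta> * R" using \<delta> by (simp add: R_def)
    also have "\<dots> \<le> \<delta> * norm z" using False \<delta> by simp
    also have "\<dots> \<le> F z" using growth that .
    finally show ?thesis .
  qed (use y that in auto)
  define G where "G = (\<Sum>i\<in>A. (c i * exp (v i \<bullet> y)) *\<^sub>R v i)"
  have G: "G \<in> ?S" unfolding G_def by (intro span_sum span_scale span_base) auto
  have "((\<lambda>t. F (y + t *\<^sub>R G)) has_real_derivative (\<Sum>i\<in>A. c i * (exp (v i \<bullet> y) * (v i \<bullet> G)))) (at 0)"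
    unfolding F_def inner_add_right inner_scaleR_right
    by (rule DERIV_sum) (auto intro!: derivative_eq_intros)
  also have "(\<Sum>i\<in>A. c i * (exp (v i \<bullet> y) * (v i \<bullet> G))) = G \<bullet> G"
    by (subst (2) G_def) (simp add: inner_sum_left mult.assoc)
  finally have "G \<bullet> G = 0"
    by (rule DERIV_local_min[of _ _ _ 1])
      (use min G y in \<open>auto intro!: span_add span_scale\<close>)
  then show ?thesis using that[of y] by (simp add: G_def)
qed

text \<open>A minimal subsum that keeps the lower bound qualifies: if no exponent increased along a
  direction \<open>u\<close> and some decreased, then letting the point run to infinity along \<open>u\<close> would remove the
  latter terms and keep the bound.\<close>
lemma exp_sum_bounded_below_critical_subsum:
  fixes v :: "'i \<Rightarrow> 'a::euclidean_space"
  assumes fin: "finite A" and c: "\<And>i. i \<in> A \<Longrightarrow> c i > 0"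
    and lower: "\<And>y. (\<Sum>i\<in>A. c i * exp (v i \<bullet> y)) \<ge> D"
  obtains B y where "B \<subseteq> A" "(\<Sum>i\<in>B. (c i * exp (v i \<bullet> y)) *\<^sub>R v i) = 0"
    "(\<Sum>i\<in>B. c i * exp (v i \<bullet> y)) \<ge> D"
proof -
  let ?P = "\<lambda>B. B \<subseteq> A \<and> (\<forall>y. (\<Sum>i\<in>B. c i * exp (v i \<bullet> y)) \<ge> D)"
  have "?P A" using lower by auto
  then obtain B where B: "?P B" and min: "\<And>B'. ?P B' \<Longrightarrow> card B \<le> card B'"
    using ex_has_least_nat[of ?P A card] by blast
  have finB: "finite B" using B fin finite_subset by blast
  have "v i \<bullet> u = 0" if neg: "\<And>i. i \<in> B \<Longrightarrow> v i \<bullet> u \<le> 0" and "i \<in> B" for u i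
  proof -
    let ?B' = "{i\<in>B. v i \<bullet> u = 0}"
    have "(\<Sum>i\<in>?B'. c i * exp (v i \<bullet> y)) \<ge> D" for y
    proof -
      have "((\<lambda>t. \<Sum>i\<in>B. c i * exp (v i \<bullet> (y + t *\<^sub>R u))) \<longlongrightarrow>
          (\<Sum>i\<in>B. if v i \<bullet> u = 0 then c i * exp (v i \<bullet> y) else 0)) at_top"
      proof (rule tendsto_sum)
        fix i assume i: "i \<in> B"
        show "((\<lambda>t. c i * exp (v i \<bullet> (y + t *\<^sub>R u))) \<longlongrightarrow>
          (if v i \<bullet> u = 0 then c i * exp (v i \<bullet> y) else 0)) at_top"
        proof (cases "v i \<bullet> u = 0")
          case False
          then have "v i \<bullet> u < 0" using neg[OF i] by simp
          then have "filterlim (\<lambda>t. (v i \<bullet> u) * t) at_bot at_top"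
            by (rule filterlim_tendsto_neg_mult_at_bot[OF tendsto_const _ filterlim_ident])
          then have "((\<lambda>t. exp ((v i \<bullet> u) * t)) \<longlongrightarrow> 0) at_top"
            by (rule filterlim_compose[OF exp_at_bot])
          from tendsto_mult_left[OF this, of "c i * exp (v i \<bullet> y)"] False show ?thesis
            by (simp add: inner_add_right exp_add mult.assoc mult.commute[of _ "v i \<bullet> u"])
        qed (simp add: inner_add_right)
      qed
      then have "(\<Sum>i\<in>B. if v i \<bullet> u = 0 then c i * exp (v i \<bullet> y) else 0) \<ge> D"
        by (rule tendsto_lowerbound) (use B in auto)
      then show ?thesis by (simp add: sum.inter_filter[OF finB])
    qed
    then have "card B \<le> card ?B'" using B by (intro min) auto
    then have "?B' = B" using finB by (intro card_subset_eq) (auto intro: antisym card_mono)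
    then show ?thesis using that by auto
  qed
  then obtain y where "(\<Sum>i\<in>B. (c i * exp (v i \<bullet> y)) *\<^sub>R v i) = 0"
    using exp_sum_has_critical_point[OF finB, of c v] c B by (metis subsetD)
  then show ?thesis using that B by blast
qed

section \<open>Decomposition into circuits\<close>

text \<open>A minimal subset whose convex hull contains the point: it is a simplex by Caratheodory, and
  a vanishing barycentric coordinate would allow dropping a vertex.\<close>
lemma convex_hull_minimal_simplex:
  fixes b :: "'a::euclidean_space"
  assumes fin: "finite S" and b: "b \<in> convex hull S"
  obtains T u where "T \<subseteq> S" "\<not> affine_dependent T" "\<And>x. x \<in> T \<Longrightarrow> u x > 0" "sum u T = 1"
    "(\<Sum>x\<in>T. u x *\<^sub>R x) = b"
proof -
  let ?P = "\<lambda>T. T \<subseteq> S \<and> b \<in> convex hull T"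
  obtain T where T: "?P T" and min: "\<And>T'. ?P T' \<Longrightarrow> card T \<le> card T'"
    using ex_has_least_nat[of ?P S card] b by blast
  have finT: "finite T" using T fin finite_subset by blast
  obtain T' where T': "T' \<subseteq> T" "int (card T') \<le> aff_dim T + 1" "b \<in> convex hull T'"
    using T caratheodory_aff_dim[of T] by blast
  then have "int (card T) \<le> aff_dim T + 1" using min[of T'] T by force
  then have indep: "\<not> affine_dependent T"
    using aff_dim_le_card[OF finT] finT by (simp add: affine_independent_iff_card)
  obtain u where u: "\<forall>x\<in>T. u x \<ge> 0" "sum u T = 1" "(\<Sum>x\<in>T. u x *\<^sub>R x) = b"
    using T by (auto simp: convex_hull_finite[OF finT])
  have "u x > 0" if x: "x \<in> T" for x
  proof (rule ccontr)
    assume "\<not> u x > 0"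
    then have "u x = 0" using u(1) x by force
    then have "sum u (T - {x}) = 1" "(\<Sum>x\<in>T - {x}. u x *\<^sub>R x) = b"
      using u finT x by (auto simp: sum_diff1)
    then have "b \<in> convex hull (T - {x})"
      using u(1) finT by (auto simp: convex_hull_finite intro!: exI[of _ u])
    then have "card T \<le> card (T - {x})" using T by (intro min) auto
    then show False using card_Diff1_less[OF finT x] by simp
  qed
  then show ?thesis using that T indep u by blast
qed

lemma inj_real_vec: "inj real_vec"
  by (auto simp: inj_def real_vec_def vec_eq_iff)

text \<open>Divided by their total, balanced weights are the coefficients of a convex combination
  equal to the centre.\<close>
lemma real_vec_balanced_circuit:
  fixes \<beta> :: "nat ^ 'n::finite"
  assumes fin: "finite A" and ne: "A \<noteq> {}" and w: "\<And>\<alpha>. \<alpha> \<in> A \<Longrightarrow> w \<alpha> > 0"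
    and bal: "(\<Sum>\<alpha>\<in>A. w \<alpha> *\<^sub>R (real_vec \<alpha> - real_vec \<beta>)) = 0"
  obtains B u where "B \<subseteq> A" "B \<noteq> {}" "\<not> affine_dependent (real_vec ` B)"
    "real_vec \<beta> \<in> rel_interior (convex hull (real_vec ` B))"
    "\<And>\<alpha>. \<alpha> \<in> B \<Longrightarrow> u \<alpha> > 0" "(\<Sum>\<alpha>\<in>B. u \<alpha> *\<^sub>R (real_vec \<alpha> - real_vec \<beta>)) = 0"
proof -
  have W: "sum w A > 0" using sum_pos[OF fin ne] w by blast
  have "real_vec \<beta> = (\<Sum>\<alpha>\<in>A. (w \<alpha> / sum w A) *\<^sub>R real_vec \<alpha>)"
  proof -
    have "sum w A *\<^sub>R real_vec \<beta> = (\<Sum>\<alpha>\<in>A. w \<alpha> *\<^sub>R real_vec \<alpha>)"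
      using bal by (simp add: scaleR_diff_right sum_subtractf scaleR_sum_left)
    then have "(1 / sum w A) *\<^sub>R (sum w A *\<^sub>R real_vec \<beta>) = (\<Sum>\<alpha>\<in>A. (w \<alpha> / sum w A) *\<^sub>R real_vec \<alpha>)"
      by (simp only: scaleR_sum_right scaleR_scaleR) simp
    then show ?thesis using W by simp
  qed
  also have "\<dots> \<in> convex hull (real_vec ` A)"
    using W w fin by (intro convex_sum)
      (auto simp: convex_convex_hull hull_inc less_imp_le sum_divide_distrib[symmetric])
  finally have "real_vec \<beta> \<in> convex hull (real_vec ` A)" .
  then obtain T u where T: "T \<subseteq> real_vec ` A" "\<not> affine_dependent T" "\<And>x. x \<in> T \<Longrightarrow> u x > 0"
    "sum u T = 1" "(\<Sum>x\<in>T. u x *\<^sub>R x) = real_vec \<beta>"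
    using convex_hull_minimal_simplex[of "real_vec ` A"] fin by blast
  obtain B where B: "B \<subseteq> A" "T = real_vec ` B" using T(1) by (meson subset_image_iff)
  have inj: "inj_on real_vec B" using inj_real_vec inj_on_subset by blast
  have "real_vec \<beta> \<in> rel_interior (convex hull (real_vec ` B))"
    using T unfolding B(2) by (subst rel_interior_convex_hull_explicit) auto
  moreover have "(\<Sum>\<alpha>\<in>B. u (real_vec \<alpha>) *\<^sub>R (real_vec \<alpha> - real_vec \<beta>)) = 0"
    using T(4,5) unfolding B(2)
    by (simp add: sum.reindex[OF inj] scaleR_diff_right sum_subtractf scaleR_sum_left[symmetric])
  ultimately show ?thesis
    using T B by (intro that[of B "u \<circ> real_vec"]) auto
qed

text \<open>The inequality \<open>exp t \<ge> 1 + t\<close>, summed with the weights, is the weighted inequality of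
  arithmetic and geometric means that makes the polynomial nonnegative; the linear terms cancel since
  the weights are balanced.  The factor \<open>s\<close> stands for a coefficient of \<open>\<beta>\<close> that may have either
  sign and may lie strictly inside the range in which the polynomial is nonnegative.\<close>
lemma balanced_PSD:
  fixes \<beta> :: "nat ^ 'n::finite"
  assumes "\<And>\<alpha>. \<alpha> \<in> A \<Longrightarrow> even_vec \<alpha>" and w: "\<And>\<alpha>. \<alpha> \<in> A \<Longrightarrow> w \<alpha> > 0"
    and bal: "(\<Sum>\<alpha>\<in>A. w \<alpha> *\<^sub>R (real_vec \<alpha> - real_vec \<beta>)) = 0" and s: "\<bar>s\<bar> \<le> 1"
  shows "(\<Sum>\<alpha>\<in>A. monomial (w \<alpha> * exp (- ((real_vec \<alpha> - real_vec \<beta>) \<bullet> y))) \<alpha>)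
    - monomial (s * sum w A) \<beta> \<in> PSD"
proof (rule PSD_if_exp_inequality[where D = "sum w A"])
  fix z
  have "0 = (\<Sum>\<alpha>\<in>A. w \<alpha> *\<^sub>R (real_vec \<alpha> - real_vec \<beta>)) \<bullet> (z - y)" using bal by simp
  also have "\<dots> = (\<Sum>\<alpha>\<in>A. w \<alpha> * ((real_vec \<alpha> - real_vec \<beta>) \<bullet> (z - y)))"
    by (simp add: inner_sum_left)
  finally have "sum w A = (\<Sum>\<alpha>\<in>A. w \<alpha> * (1 + (real_vec \<alpha> - real_vec \<beta>) \<bullet> (z - y)))"
    by (simp add: distrib_left sum.distrib)
  also have "\<dots> \<le> (\<Sum>\<alpha>\<in>A. w \<alpha> * exp ((real_vec \<alpha> - real_vec \<beta>) \<bullet> (z - y)))"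
    using w by (intro sum_mono mult_left_mono) (auto simp: less_imp_le)
  finally have "sum w A * exp (real_vec \<beta> \<bullet> z) \<le>
    (\<Sum>\<alpha>\<in>A. w \<alpha> * exp ((real_vec \<alpha> - real_vec \<beta>) \<bullet> (z - y))) * exp (real_vec \<beta> \<bullet> z)"
    by (intro mult_right_mono) auto
  also have "\<dots> = (\<Sum>\<alpha>\<in>A. w \<alpha> * exp (- ((real_vec \<alpha> - real_vec \<beta>) \<bullet> y)) * exp (real_vec \<alpha> \<bullet> z))"
    unfolding sum_distrib_right
    by (intro sum.cong refl) (simp add: mult.assoc exp_add[symmetric] inner_diff_left inner_diff_right)
  finally show "sum w A * exp (real_vec \<beta> \<bullet> z) \<le>
    (\<Sum>\<alpha>\<in>A. w \<alpha> * exp (- ((real_vec \<alpha> - real_vec \<beta>) \<bullet> y)) * exp (real_vec \<alpha> \<bullet> z))" .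
next
  have "sum w A \<ge> 0" using w by (intro sum_nonneg) (auto simp: less_imp_le)
  then show "\<bar>s * sum w A\<bar> \<le> sum w A" using s by (simp add: abs_mult mult_left_le_one_le)
qed (use assms in auto)

text \<open>The polynomial depends linearly on the weights \<open>w\<close>.  So the largest multiple of a circuit
  inside the support that keeps the weights nonnegative may be split off; this shrinks the
  support.\<close>
lemma balanced_SONC:
  fixes \<beta> :: "nat ^ 'n::finite"
  assumes "finite A" and "\<And>\<alpha>. \<alpha> \<in> A \<Longrightarrow> even_vec \<alpha>" and "\<And>\<alpha>. \<alpha> \<in> A \<Longrightarrow> w \<alpha> > 0"
    and "(\<Sum>\<alpha>\<in>A. w \<alpha> *\<^sub>R (real_vec \<alpha> - real_vec \<beta>)) = 0" and s: "\<bar>s\<bar> \<le> 1"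
  shows "(\<Sum>\<alpha>\<in>A. monomial (w \<alpha> * exp (- ((real_vec \<alpha> - real_vec \<beta>) \<bullet> y))) \<alpha>)
    - monomial (s * sum w A) \<beta> \<in> SONC"
  using assms(1-4)
proof (induction A arbitrary: w rule: finite_psubset_induct)
  case (psubset A)
  let ?e = "\<lambda>\<alpha>. exp (- ((real_vec \<alpha> - real_vec \<beta>) \<bullet> y))"
  define P where "P A w = (\<Sum>\<alpha>\<in>A. monomial (w \<alpha> * ?e \<alpha>) \<alpha>) - monomial (s * sum w A) \<beta>" for A w
  define M where "M A w = (\<Sum>\<alpha>\<in>A. w \<alpha> *\<^sub>R (real_vec \<alpha> - real_vec \<beta>))" for A w
  have mono: "P A' w = P A w" "M A' w = M A w" if "A' \<subseteq> A" "\<And>\<alpha>. \<alpha> \<in> A - A' \<Longrightarrow> w \<alpha> = 0" for A' w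
  proof -
    have "(\<Sum>\<alpha>\<in>A'. monomial (w \<alpha> * ?e \<alpha>) \<alpha>) = (\<Sum>\<alpha>\<in>A. monomial (w \<alpha> * ?e \<alpha>) \<alpha>)"
      "sum w A' = sum w A"
      using that psubset(1) by (auto intro!: sum.mono_neutral_left)
    then show "P A' w = P A w" by (simp add: P_def)
    show "M A' w = M A w"
      unfolding M_def using that psubset(1) by (auto intro!: sum.mono_neutral_left)
  qed
  show ?case
  proof (cases "A = {}")
    case True
    then show ?thesis by (simp add: zero_in_SONC)
  next
    case False
    obtain B u where B: "B \<subseteq> A" "B \<noteq> {}" "\<not> affine_dependent (real_vec ` B)"
      "real_vec \<beta> \<in> rel_interior (convex hull (real_vec ` B))"
      and u: "\<And>\<alpha>. \<alpha> \<in> B \<Longrightarrow> u \<alpha> > 0" "(\<Sum>\<alpha>\<in>B. u \<alpha> *\<^sub>R (real_vec \<alpha> - real_vec \<beta>)) = 0"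
      using real_vec_balanced_circuit[OF psubset(1) False psubset(4,5)] by blast
    have finB: "finite B" using B psubset(1) finite_subset by blast
    define t where "t = Min ((\<lambda>\<alpha>. w \<alpha> / u \<alpha>) ` B)"
    have "t \<in> (\<lambda>\<alpha>. w \<alpha> / u \<alpha>) ` B" unfolding t_def using finB B by (intro Min_in) auto
    then obtain \<gamma> where \<gamma>: "\<gamma> \<in> B" "t = w \<gamma> / u \<gamma>" by auto
    have t_pos: "t > 0" using \<gamma> u psubset(4) B by auto
    have t_le: "t * u \<alpha> \<le> w \<alpha>" if "\<alpha> \<in> B" for \<alpha>
    proof -
      have "t \<le> w \<alpha> / u \<alpha>" unfolding t_def using finB that by (intro Min_le) auto
      then show ?thesis using u(1)[OF that] by (simp add: field_simps)
    qed
    define w1 where "w1 \<alpha> = (if \<alpha> \<in> B then t * u \<alpha> else 0)" for \<alpha>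
    define w2 where "w2 \<alpha> = w \<alpha> - w1 \<alpha>" for \<alpha>
    define A2 where "A2 = {\<alpha>\<in>A. w2 \<alpha> > 0}"
    have w2_nn: "w2 \<alpha> \<ge> 0" if "\<alpha> \<in> A" for \<alpha>
      using t_le psubset(4)[OF that] by (auto simp: w1_def w2_def less_imp_le)
    have "w2 \<gamma> = 0" using \<gamma> u(1)[OF \<gamma>(1)] by (simp add: w1_def w2_def)
    then have "\<gamma> \<in> A - A2" "A2 \<subseteq> A" using \<gamma> B by (auto simp: A2_def)
    then have A2: "A2 \<subset> A" by blast
    have M1: "M B w1 = 0"
    proof -
      have "M B w1 = t *\<^sub>R (\<Sum>\<alpha>\<in>B. u \<alpha> *\<^sub>R (real_vec \<alpha> - real_vec \<beta>))"
        by (simp add: M_def w1_def scaleR_sum_right)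
      then show ?thesis by (simp add: u(2))
    qed
    have w1_pos: "w1 \<alpha> > 0" if "\<alpha> \<in> B" for \<alpha> using that u t_pos by (simp add: w1_def)
    have evenB: "even_vec \<alpha>" if "\<alpha> \<in> B" for \<alpha> using that B psubset(3) by auto
    have "P B w1 \<in> PSD"
      unfolding P_def by (rule balanced_PSD[OF evenB w1_pos M1[unfolded M_def] s])
    moreover have "circuit_polynomial (P B w1)"
      unfolding circuit_polynomial_def trellis_def P_def
      using finB evenB B w1_pos
      by (intro exI[of _ B] exI[of _ "\<lambda>\<alpha>. w1 \<alpha> * ?e \<alpha>"] exI[of _ "s * sum w1 B"] exI[of _ \<beta>]) auto
    ultimately have "P B w1 \<in> SONC"
      by (simp add: nonneg_circuit_in_SONC nonneg_circuit_polynomial_def)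
    moreover have "P B w1 = P A w1" "M B w1 = M A w1"
      using B by (intro mono; simp add: w1_def)+
    moreover have eq2: "P A2 w2 = P A w2" "M A2 w2 = M A w2"
      using A2 w2_nn by (intro mono; force simp: A2_def)+
    moreover have "M A2 w2 = 0"
    proof -
      have "M A w2 = M A w - M A w1"
        by (simp add: M_def w2_def scaleR_diff_left sum_subtractf)
      then show ?thesis using psubset(5) M1 \<open>M B w1 = M A w1\<close> eq2 by (simp add: M_def)
    qed
    then have "P A2 w2 \<in> SONC"
      unfolding P_def using A2 psubset(3)
      by (intro psubset.IH) (auto simp: A2_def M_def)
    moreover have "P A w = P A w1 + P A w2"
      by (simp add: P_def w2_def left_diff_distrib right_diff_distrib sum_subtractf
          single_diff sum.distrib)
    ultimately show ?thesis using SONC_add by (metis P_def)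
  qed
qed

section \<open>Polynomials with one possibly negative term\<close>

lemma PSD_imp_SONC_distinct_exponents:
  fixes \<beta> :: "nat ^ 'n::finite"
  assumes fin: "finite A" and even: "\<And>\<alpha>. \<alpha> \<in> A \<Longrightarrow> even_vec \<alpha>" and c: "\<And>\<alpha>. \<alpha> \<in> A \<Longrightarrow> c \<alpha> > 0"
    and psd: "(\<Sum>\<alpha>\<in>A. monomial (c \<alpha>) \<alpha>) - monomial d \<beta> \<in> PSD"
  shows "(\<Sum>\<alpha>\<in>A. monomial (c \<alpha>) \<alpha>) - monomial d \<beta> \<in> SONC"
proof (cases "d = 0 \<or> d < 0 \<and> even_vec \<beta>")
  case True
  have "(\<Sum>\<alpha>\<in>A. monomial (c \<alpha>) \<alpha>) \<in> SONC"
    using even c by (intro sum_in_SONC even_monomial_in_SONC) (auto simp: less_imp_le)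
  moreover have "monomial (- d) \<beta> \<in> SONC"
    using True by (auto intro: even_monomial_in_SONC simp: zero_in_SONC)
  ultimately show ?thesis using SONC_add by (fastforce simp: single_uminus)
next
  case False
  let ?v = "\<lambda>\<alpha>. real_vec \<alpha> - real_vec \<beta>"
  have "\<bar>d\<bar> \<le> (\<Sum>\<alpha>\<in>A. c \<alpha> * exp (?v \<alpha> \<bullet> y))" for y
  proof -
    have "\<bar>d\<bar> * exp (real_vec \<beta> \<bullet> y) \<le> (\<Sum>\<alpha>\<in>A. c \<alpha> * exp (real_vec \<alpha> \<bullet> y))"
      by (rule exp_inequality_if_PSD[OF even psd]) (use False in auto)
    then have "\<bar>d\<bar> \<le> (\<Sum>\<alpha>\<in>A. c \<alpha> * exp (real_vec \<alpha> \<bullet> y)) / exp (real_vec \<beta> \<bullet> y)"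
      by (simp add: field_simps)
    then show ?thesis by (simp add: sum_divide_distrib inner_diff_left exp_diff)
  qed
  then obtain B y where B: "B \<subseteq> A" "(\<Sum>\<alpha>\<in>B. (c \<alpha> * exp (?v \<alpha> \<bullet> y)) *\<^sub>R ?v \<alpha>) = 0"
    "(\<Sum>\<alpha>\<in>B. c \<alpha> * exp (?v \<alpha> \<bullet> y)) \<ge> \<bar>d\<bar>"
    using exp_sum_bounded_below_critical_subsum[of A c "\<bar>d\<bar>" ?v] fin c by blast
  define w where "w \<alpha> = c \<alpha> * exp (?v \<alpha> \<bullet> y)" for \<alpha>
  have W: "sum w B \<ge> \<bar>d\<bar>" "sum w B > 0" using B(3) False by (auto simp: w_def)
  have "(\<Sum>\<alpha>\<in>B. monomial (w \<alpha> * exp (- (?v \<alpha> \<bullet> y))) \<alpha>) - monomial (d / sum w B * sum w B) \<beta> \<in> SONC"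
  proof (rule balanced_SONC)
    show "finite B" using B(1) fin finite_subset by blast
    show "(\<Sum>\<alpha>\<in>B. w \<alpha> *\<^sub>R ?v \<alpha>) = 0" using B(2) by (simp add: w_def)
    show "\<bar>d / sum w B\<bar> \<le> 1" using W by simp
  qed (use B c even in \<open>auto simp: w_def\<close>)
  moreover have "w \<alpha> * exp (- (?v \<alpha> \<bullet> y)) = c \<alpha>" for \<alpha>
    by (simp add: w_def mult.assoc exp_add[symmetric])
  ultimately have "(\<Sum>\<alpha>\<in>B. monomial (c \<alpha>) \<alpha>) - monomial d \<beta> \<in> SONC"
    using W(2) by simp
  moreover have "(\<Sum>\<alpha>\<in>A - B. monomial (c \<alpha>) \<alpha>) \<in> SONC"
    using even c by (intro sum_in_SONC even_monomial_in_SONC) (auto simp: less_imp_le)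
  moreover have "(\<Sum>\<alpha>\<in>A. monomial (c \<alpha>) \<alpha>) =
      (\<Sum>\<alpha>\<in>A - B. monomial (c \<alpha>) \<alpha>) + (\<Sum>\<alpha>\<in>B. monomial (c \<alpha>) \<alpha>)"
    by (rule sum.subset_diff[OF B(1) fin])
  ultimately show ?thesis using SONC_add by (fastforce simp: algebra_simps)
qed

theorem theorem1p1:
  fixes f :: "'n::finite polynomial"
    and \<alpha> :: "nat \<Rightarrow> nat ^ 'n" and \<beta> :: "nat ^ 'n"
    and c :: "nat \<Rightarrow> real" and d\<^sub>0 :: real and m :: nat
  assumes "\<And>i. i \<in> {1..m} \<Longrightarrow> even_vec (\<alpha> i)"
    and "\<And>i. i \<in> {1..m} \<Longrightarrow> c i > 0"
    and "f = (\<Sum>i=1..m. monomial (c i) (\<alpha> i)) - monomial d\<^sub>0 \<beta>"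
  shows "f \<in> PSD \<longleftrightarrow> f \<in> SONC"
proof
  let ?A = "\<alpha> ` {1..m}"
  \<comment> \<open>The exponents \<open>\<alpha> i\<close> may repeat, so equal ones are collected.\<close>
  define C where "C a = (\<Sum>i\<in>{i\<in>{1..m}. \<alpha> i = a}. c i)" for a
  have single_sum: "monomial (\<Sum>i\<in>I. c i) a = (\<Sum>i\<in>I. monomial (c i) a)" for I a
    by (induction I rule: infinite_finite_induct) (auto simp: single_add)
  have "(\<Sum>i=1..m. monomial (c i) (\<alpha> i)) =
      (\<Sum>a\<in>?A. \<Sum>i\<in>{i\<in>{1..m}. \<alpha> i = a}. monomial (c i) (\<alpha> i))"
    by (rule sum.image_gen) simp
  also have "\<dots> = (\<Sum>a\<in>?A. monomial (C a) a)"
    unfolding C_def single_sum by (intro sum.cong) auto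
  finally have f: "f = (\<Sum>a\<in>?A. monomial (C a) a) - monomial d\<^sub>0 \<beta>"
    using assms(3) by simp
  assume "f \<in> PSD"
  then show "f \<in> SONC"
    unfolding f
  proof (intro PSD_imp_SONC_distinct_exponents)
    fix a assume "a \<in> ?A"
    then show "C a > 0" unfolding C_def using assms(2) by (intro sum_pos) auto
  qed (use assms(1) in auto)
next
  assume "f \<in> SONC"
  then show "f \<in> PSD" using SONC_subset_PSD by blast
qed

end
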